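(* Let $n\geq 1$ be an integer and let $A$ be the adjacency matrix and $L$ the Laplacian matrix of the simplicial rook graph $\mathrm{SR}(3,n)$. Then $\mathrm{SR}(3,n)$ is integral and Laplacian integral. More precisely, the eigenvalues of $A$, with multiplicities, are as follows (the eigenvalue of $L$ corresponding to an eigenvalue $\lambda$ of $A$ is $2n-\lambda$, with the same multiplicity). If $n=2m+1$ is odd: - $-3$ with multiplicity $\binom{2m}{2}$ (Laplacian eigenvalue $4m+5=2n+3$); - each of $-2,-1,\dots,m-3$ with multiplicity $3$ (Laplacian eigenvalues $4m+4,\dots,3m+5$); - $m-1$ with multiplicity $2$ (Laplacian eigenvalue $3m+3$); - each of $m,m+1,\dots,2m-1=n-2$ with multiplicity $3$ (Laplacian eigenvalues $3m+2,\dots,2m+3$); - $4m+2=2n$ with multiplicity $1$ (Laplacian eigenvalue $0$). If $n=2m$ is even: - $-3$ with multiplicity $\binom{2m-1}{2}$ (Laplacian eigenvalue $4m+3=2n+3$); - each of $-2,-1,\dots,m-4$ with multiplicity $3$ (Laplacian eigenvalues $4m+2,\dots,3m+4$); - $m-3$ with multiplicity $2$ (Laplacian eigenvalue $3m+3$); - each of $m-1,m,\dots,2m-2=n-2$ with multiplicity $3$ (Laplacian eigenvalues $3m+1,\dots,2m+2$); - $4m=2n$ with multiplicity $1$ (Laplacian eigenvalue $0$). (Ranges such as $-2,\dots,m-3$ are empty when their upper end is smaller than their lower end.)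
   Context: For nonnegative integers $d,n$, the simplicial rook graph $\mathrm{SR}(d,n)$ has vertex set $V(d,n)=\{x=(x_1,\dots,x_d)\in\mathbb{Z}^d: 0\le x_i\le n,\ \sum_i x_i=n\}$, with two vertices adjacent if they differ in exactly two coordinates. The adjacency matrix $A$ has $(x,y)$ entry $1$ if $x,y$ are adjacent and $0$ otherwise; the Laplacian is $L=D-A$ with $D$ the diagonal matrix of degrees. A graph is integral (resp. Laplacian integral) if all eigenvalues of $A$ (resp. $L$) are integers. The graph $\mathrm{SR}(3,n)$ is $2n$-regular. *)

theory Defs
  imports
    "Jordan_Normal_Form.Char_Poly"
    "HOL-Computational_Algebra.Polynomial"
    "HOL.Complex"
begin

definition SR_vertices :: "nat \<Rightarrow> nat \<Rightarrow> int list set" where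
  "SR_vertices d n =
     {x. length x = d \<and> (\<forall>i<d. 0 \<le> x ! i \<and> x ! i \<le> int n) \<and> (\<Sum>i<d. x ! i) = int n}"

definition SR_adj :: "nat \<Rightarrow> int list \<Rightarrow> int list \<Rightarrow> bool" where
  "SR_adj d x y \<longleftrightarrow> card {i. i < d \<and> x ! i \<noteq> y ! i} = 2"

text \<open>A finite graph is given by its adjacency relation and a list enumerating its vertices without
  repetition; the list fixes the order in which the rows and columns of the matrices are indexed.
  Entries are complex so that the spectrum is not restricted in advance.\<close>

definition adjacency_matrix :: "('v \<Rightarrow> 'v \<Rightarrow> bool) \<Rightarrow> 'v list \<Rightarrow> complex mat" where
  "adjacency_matrix E vs =
     mat (length vs) (length vs) (\<lambda>(i, j). if E (vs ! i) (vs ! j) then 1 else 0)"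

definition degree_matrix :: "('v \<Rightarrow> 'v \<Rightarrow> bool) \<Rightarrow> 'v list \<Rightarrow> complex mat" where
  "degree_matrix E vs =
     mat (length vs) (length vs)
       (\<lambda>(i, j). if i = j then of_nat (card {w \<in> set vs. E (vs ! i) w}) else 0)"

definition laplacian_matrix :: "('v \<Rightarrow> 'v \<Rightarrow> bool) \<Rightarrow> 'v list \<Rightarrow> complex mat" where
  "laplacian_matrix E vs = degree_matrix E vs - adjacency_matrix E vs"

definition integral_graph :: "('v \<Rightarrow> 'v \<Rightarrow> bool) \<Rightarrow> 'v list \<Rightarrow> bool" where
  "integral_graph E vs \<longleftrightarrow> (\<forall>k. eigenvalue (adjacency_matrix E vs) k \<longrightarrow> k \<in> \<int>)"

definition laplacian_integral_graph :: "('v \<Rightarrow> 'v \<Rightarrow> bool) \<Rightarrow> 'v list \<Rightarrow> bool" where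
  "laplacian_integral_graph E vs \<longleftrightarrow> (\<forall>k. eigenvalue (laplacian_matrix E vs) k \<longrightarrow> k \<in> \<int>)"

text \<open>The eigenvalues of a matrix, each repeated according to its algebraic multiplicity.\<close>

definition eigenvalue_mset :: "complex mat \<Rightarrow> complex multiset" where
  "eigenvalue_mset M = proots (char_poly M)"

lemma finite_SR_vertices: "finite (SR_vertices d n)"
proof (rule finite_subset)
  show "SR_vertices d n \<subseteq> {x. set x \<subseteq> {0..int n} \<and> length x = d}"
    by (auto simp: SR_vertices_def in_set_conv_nth)
  show "finite {x. set x \<subseteq> {0..int n} \<and> length x = d}"
    by (rule finite_lists_length_eq) simp
qed

lemma ex_SR_enumeration: "\<exists>vs. distinct vs \<and> set vs = SR_vertices d n"
  using finite_distinct_list[OF finite_SR_vertices[of d n]] by blast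

end

theory Submission
  imports Defs "Jordan_Normal_Form.Schur_Decomposition"
begin

text \<open>
  Two distinct vertices of SR(3,n) share at most one coordinate, so \<open>A + 3I = NN\<^sup>T\<close>, where \<open>N\<close> is
  the incidence matrix of the vertices against the \<open>3(n+1)\<close> lines \<open>x\<^sub>i = k\<close>. Up to zeros, \<open>NN\<^sup>T\<close> and
  \<open>N\<^sup>TN\<close> have the same spectrum. The \<open>3 \<times> 3\<close> block matrix \<open>N\<^sup>TN\<close> has \<open>D = diag(n+1-k)\<close> on its
  diagonal and \<open>B = [k + l \<le> n]\<close> everywhere else, so its spectrum is that of \<open>D + 2B\<close> together with
  two copies of that of \<open>D - B\<close>. Both of these matrices have \<open>n + 1\<close> distinct eigenvalues, with
  explicit eigenvectors whose entries are piecewise linear.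
\<close>

section \<open>Spectra of complex matrices as multisets\<close>

lemma char_poly_nonzero:
  fixes M :: "complex mat"
  assumes "M \<in> carrier_mat d d"
  shows "char_poly M \<noteq> 0"
  using degree_monic_char_poly[OF assms] by auto

lemma eigenvalue_mset_similar: "similar_mat M M' \<Longrightarrow> eigenvalue_mset M = eigenvalue_mset M'"
  by (simp add: eigenvalue_mset_def char_poly_similar)

lemma proots_linear_factors: "proots (\<Prod>a\<leftarrow>as. [:- a, 1:]) = mset (as :: complex list)"
proof (induction as)
  case (Cons a as)
  have "(\<Prod>a\<leftarrow>as. [:- a, 1:]) \<noteq> 0"
    by (auto simp: prod_list_zero_iff)
  with Cons show ?case
    by (simp add: proots_mult del: mult_pCons_left)
qed simp

lemma eigenvalue_mset_upper_triangular:
  assumes "M \<in> carrier_mat d d" "upper_triangular M"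
  shows "eigenvalue_mset M = mset (diag_mat M)"
  by (simp add: eigenvalue_mset_def char_poly_upper_triangular[OF assms] proots_linear_factors)

lemma in_eigenvalue_mset_iff:
  assumes "M \<in> carrier_mat d d"
  shows "k \<in># eigenvalue_mset M \<longleftrightarrow> eigenvalue M k"
  by (simp add: eigenvalue_mset_def eigenvalue_root_char_poly[OF assms] char_poly_nonzero[OF assms])

lemma size_eigenvalue_mset:
  assumes "M \<in> carrier_mat d d"
  shows "size (eigenvalue_mset M) = d"
  using degree_monic_char_poly[OF assms] by (simp add: eigenvalue_mset_def size_proots_complex)

lemma eigenvalue_mset_zero_mat: "eigenvalue_mset (0\<^sub>m d d) = replicate_mset d 0"
proof -
  have "diag_mat (0\<^sub>m d d :: complex mat) = replicate d 0"
    by (rule nth_equalityI) (auto simp: diag_mat_def)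
  then show ?thesis
    by (simp add: eigenvalue_mset_upper_triangular[of _ d])
qed

lemma eigenvalue_mset_block_triangular:
  assumes "B \<in> carrier_mat d d" "C \<in> carrier_mat d e" "D \<in> carrier_mat e e"
  shows "eigenvalue_mset (four_block_mat B C (0\<^sub>m e d) D) = eigenvalue_mset B + eigenvalue_mset D"
proof -
  have "char_poly (four_block_mat B C (0\<^sub>m e d) D) = char_poly B * char_poly D"
    using char_poly_factorized[OF assms(1)] char_poly_factorized[OF assms(3)]
    by (intro char_poly_0_block[OF refl]) (use assms in auto)
  then show ?thesis
    using assms by (simp add: eigenvalue_mset_def proots_mult char_poly_nonzero)
qed

text \<open>The matrices \<open>P\<close>, \<open>Q\<close> of a Schur triangularisation of
  \<open>M\<close> also conjugate \<open>a I + b M\<close> to an upper triangular matrix, whose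
  diagonal is the affine image of the old one.\<close>

lemma eigenvalue_mset_affine:
  fixes M :: "complex mat"
  assumes M: "M \<in> carrier_mat d d"
  shows "eigenvalue_mset (a \<cdot>\<^sub>m 1\<^sub>m d + b \<cdot>\<^sub>m M) = image_mset (\<lambda>k. a + b * k) (eigenvalue_mset M)"
proof -
  obtain es where "char_poly M = (\<Prod>a\<leftarrow>es. [:- a, 1:])"
    using char_poly_factorized[OF M] by blast
  from schur_decomposition_exists[OF M this] obtain T
    where T: "T \<in> carrier_mat d d" "upper_triangular T" and sim: "similar_mat M T"
    by blast
  obtain P Q where PQ: "P \<in> carrier_mat d d" "Q \<in> carrier_mat d d"
    "P * Q = 1\<^sub>m d" "Q * P = 1\<^sub>m d" "M = P * T * Q"
    using sim M unfolding similar_mat_def similar_mat_wit_def Let_def by auto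
  let ?T = "a \<cdot>\<^sub>m 1\<^sub>m d + b \<cdot>\<^sub>m T"
  have "P * ?T * Q = (a \<cdot>\<^sub>m P + b \<cdot>\<^sub>m (P * T)) * Q"
    using PQ(1,2) T(1) by (simp add: mult_add_distrib_mat[of _ d d _ d] mult_smult_distrib[of _ d d _ d])
  also have "\<dots> = a \<cdot>\<^sub>m (P * Q) + b \<cdot>\<^sub>m (P * T * Q)"
    using PQ(1,2) T(1) by (simp add: add_mult_distrib_mat[of _ d d _ _ d] mult_smult_assoc_mat[of _ d d _ d])
  also have "\<dots> = a \<cdot>\<^sub>m 1\<^sub>m d + b \<cdot>\<^sub>m M"
    using PQ(3,5) by simp
  finally have "similar_mat (a \<cdot>\<^sub>m 1\<^sub>m d + b \<cdot>\<^sub>m M) ?T"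
    using PQ T(1) M by (intro similar_matI[of _ _ P Q d]) auto
  moreover have "upper_triangular ?T"
    using T by (auto simp: upper_triangular_def)
  moreover have "diag_mat ?T = map (\<lambda>k. a + b * k) (diag_mat T)"
    using T(1) by (auto simp: diag_mat_def)
  ultimately show ?thesis
    using T sim by (simp add: eigenvalue_mset_similar[of _ ?T] eigenvalue_mset_similar[of _ T]
        eigenvalue_mset_upper_triangular[of _ d])
qed

text \<open>The two products differ only in zeros; the padding brings both sides to size
  \<open>p + r\<close> without subtracting multisets.\<close>

lemma eigenvalue_mset_mult_commute:
  fixes N M :: "complex mat"
  assumes N: "N \<in> carrier_mat p r" and M: "M \<in> carrier_mat r p"
  shows "eigenvalue_mset (N * M) + replicate_mset r 0 = eigenvalue_mset (M * N) + replicate_mset p 0"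
proof -
  let ?X = "four_block_mat (N * M) N (0\<^sub>m r p) (0\<^sub>m r r)"
  let ?Y = "four_block_mat (0\<^sub>m p p) N (0\<^sub>m r p) (M * N)"
  let ?Z = "four_block_mat (0\<^sub>m p p) N (0\<^sub>m r p) (0\<^sub>m r r)"
  let ?P = "four_block_mat (1\<^sub>m p) (0\<^sub>m p r) M (1\<^sub>m r)"
  let ?Q = "four_block_mat (1\<^sub>m p) (0\<^sub>m p r) (- M) (1\<^sub>m r)"
  have c: "?X \<in> carrier_mat (p + r) (p + r)" "?Y \<in> carrier_mat (p + r) (p + r)"
    "?Z \<in> carrier_mat (p + r) (p + r)"
    "?P \<in> carrier_mat (p + r) (p + r)" "?Q \<in> carrier_mat (p + r) (p + r)"
    using N M by auto
  have m: "- M \<in> carrier_mat r p" "M + - M = 0\<^sub>m r p" "- M + M = 0\<^sub>m r p"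
    "- 0\<^sub>m p p = (0\<^sub>m p p :: complex mat)"
    using M by auto
  have PQ: "?P * ?Q = 1\<^sub>m (p + r)" "?Q * ?P = 1\<^sub>m (p + r)"
    using N M m by (auto simp: mult_four_block_mat[of _ p p _ r _ r _ _ p _ r])
  \<comment> \<open>From \<open>?X = ?Z * ?P\<close> and \<open>?Y = ?P * ?Z\<close>, conjugation by
    the invertible \<open>?P\<close> carries \<open>?X\<close> to \<open>?Y\<close>.\<close>
  have "?Z * ?P = ?X"
    using N M by (subst mult_four_block_mat[of _ p p _ r _ r _ _ p _ r]) auto
  moreover have "?P * ?Z = ?Y"
    using N M by (subst mult_four_block_mat[of _ p p _ r _ r _ _ p _ r]) auto
  ultimately have "?P * ?X = ?Y * ?P"
    using assoc_mult_mat[OF c(4) c(3) c(4)] by simp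
  then have Y: "?Y = ?P * ?X * ?Q"
    using PQ(1) c assoc_mult_mat[OF c(2) c(4) c(5)] right_mult_one_mat[OF c(2)] by simp
  have "similar_mat ?Y ?X"
    using c by (intro similar_matI[OF _ PQ Y]) simp
  then have "eigenvalue_mset ?Y = eigenvalue_mset ?X"
    by (rule eigenvalue_mset_similar)
  moreover have "eigenvalue_mset ?X = eigenvalue_mset (N * M) + replicate_mset r 0"
    using N M by (simp add: eigenvalue_mset_block_triangular[of _ p _ r] eigenvalue_mset_zero_mat)
  moreover have "eigenvalue_mset ?Y = replicate_mset p 0 + eigenvalue_mset (M * N)"
    using N M by (simp add: eigenvalue_mset_block_triangular[of _ p _ r] eigenvalue_mset_zero_mat)
  ultimately show ?thesis by (simp add: add.commute)
qed

text \<open>As many distinct eigenvalues as the size of the matrix already exhaust the spectrum, so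
  each is simple.\<close>

lemma eigenvalue_mset_distinct:
  assumes M: "M \<in> carrier_mat d d" and S: "finite S" "card S = d"
    and ev: "\<And>k. k \<in> S \<Longrightarrow> eigenvalue M (of_int k)"
  shows "eigenvalue_mset M = image_mset of_int (mset_set S)"
proof -
  have inj: "inj_on (of_int :: int \<Rightarrow> complex) S" by (auto simp: inj_on_def)
  have "mset_set (of_int ` S) \<subseteq># eigenvalue_mset M"
    using ev S by (auto simp: subseteq_mset_def count_mset_set' Suc_le_eq in_eigenvalue_mset_iff[OF M])
  moreover have "size (mset_set (of_int ` S :: complex set)) = size (eigenvalue_mset M)"
    using S by (simp add: size_eigenvalue_mset[OF M] card_image[OF inj])
  ultimately have "mset_set (of_int ` S) = eigenvalue_mset M"
    by (metis less_irrefl mset_subset_size subset_mset.less_le)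
  then show ?thesis by (simp add: image_mset_mset_set[OF inj])
qed

section \<open>Spectra of the matrices \<open>D + s B\<close>, here
  \<open>staircase_mat n s\<close>\<close>

definition staircase_mat :: "nat \<Rightarrow> int \<Rightarrow> complex mat" where
  "staircase_mat n s = mat (n + 1) (n + 1)
     (\<lambda>(k, l). (if k = l then of_nat (n + 1 - k) else 0) + (if k + l \<le> n then of_int s else 0))"

lemma staircase_mat_carrier [simp]: "staircase_mat n s \<in> carrier_mat (n + 1) (n + 1)"
  by (simp add: staircase_mat_def)

text \<open>\<open>G\<close> is the sequence of partial sums of the eigenvector.\<close>

lemma eigenvalue_staircase:
  fixes G :: "int \<Rightarrow> int"
  assumes G0: "G (-1) = 0"
    and eq: "\<And>k. 0 \<le> k \<Longrightarrow> k \<le> int n \<Longrightarrow>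
      (int n + 1 - k - c) * (G k - G (k - 1)) + s * G (int n - k) = 0"
    and j: "0 \<le> j" "j \<le> int n" "G j \<noteq> 0"
  shows "eigenvalue (staircase_mat n s) (of_int c)"
proof -
  define f where "f l = G (int l) - G (int l - 1)" for l
  define v where "v = vec (n + 1) (\<lambda>l. complex_of_int (f l))"
  have sum: "(\<Sum>l<l'. f l) = G (int l' - 1)" for l'
    by (induction l') (auto simp: f_def G0)
  have "v \<noteq> 0\<^sub>v (n + 1)"
  proof
    assume z: "v = 0\<^sub>v (n + 1)"
    have "f l = 0" if "l < n + 1" for l
      using arg_cong[OF z, of "\<lambda>v. v $ l"] that by (simp add: v_def)
    \<comment> \<open>The entries up to index \<open>j\<close> add up to \<open>G j\<close>, which
      is nonzero.\<close>
    then have "(\<Sum>l<nat j + 1. f l) = 0"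
      using j by (intro sum.neutral) auto
    then show False using sum[of "nat j + 1"] j by simp
  qed
  moreover have "staircase_mat n s *\<^sub>v v = of_int c \<cdot>\<^sub>v v"
  proof (rule eq_vecI)
    fix k assume "k < dim_vec (of_int c \<cdot>\<^sub>v v)"
    then have k: "k \<le> n" by (simp add: v_def)
    have "(staircase_mat n s *\<^sub>v v) $ k =
      (\<Sum>l<n+1. ((if k = l then of_nat (n + 1 - k) else 0) + (if k + l \<le> n then of_int s else 0)) * of_int (f l))"
      using k by (auto simp: staircase_mat_def v_def scalar_prod_def atLeast0LessThan intro!: sum.cong)
    also have "\<dots> = (\<Sum>l<n+1. if k = l then of_nat (n + 1 - k) * of_int (f l) else 0)
        + (\<Sum>l<n+1. if k + l \<le> n then of_int s * of_int (f l) else 0)"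
      unfolding sum.distrib[symmetric] by (intro sum.cong) (auto simp: algebra_simps)
    also have "(\<Sum>l<n+1. if k = l then of_nat (n + 1 - k) * of_int (f l) else (0::complex))
        = of_int ((int n + 1 - int k) * f k)"
      using k by (simp add: of_nat_diff)
    also have "(\<Sum>l<n+1. if k + l \<le> n then of_int s * complex_of_int (f l) else 0)
        = (\<Sum>l<n - k + 1. of_int s * of_int (f l))"
      using k by (intro sum.mono_neutral_cong_right) auto
    also have "\<dots> = of_int (s * (\<Sum>l<n - k + 1. f l))"
      unfolding sum_distrib_left of_int_sum of_int_mult ..
    \<comment> \<open>Row \<open>k\<close> of \<open>B\<close> selects the first
      \<open>n - k + 1\<close> entries, hence a partial sum; this turns the eigenvector equation
      into \<open>eq\<close>.\<close>
    also have "(\<Sum>l<n - k + 1. f l) = G (int n - int k)"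
      using k by (simp only: sum) (simp add: of_nat_diff)
    also have "complex_of_int ((int n + 1 - int k) * f k) + of_int (s * G (int n - int k))
        = of_int (c * f k)"
      unfolding of_int_add[symmetric] of_int_eq_iff
      using eq[of "int k"] k by (simp add: f_def algebra_simps)
    finally show "(staircase_mat n s *\<^sub>v v) $ k = (of_int c \<cdot>\<^sub>v v) $ k"
      using k by (simp add: v_def)
  qed (simp add: staircase_mat_def v_def)
  ultimately show ?thesis
    unfolding eigenvalue_def eigenvector_def
    by (intro exI[of _ v]) (simp add: v_def staircase_mat_def)
qed

text \<open>For a polynomial \<open>G\<close> of degree \<open>d\<close>, comparing leading terms in
  the equation of \<open>eigenvalue_staircase\<close> gives \<open>d = s * (-1)^d\<close>, so
  \<open>s = -1\<close> calls for affine pieces. The integer left out is the one for which both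
  witnesses below vanish identically.\<close>

lemma eigenvalue_mset_staircase_minus:
  "eigenvalue_mset (staircase_mat n (-1))
    = image_mset of_int (mset_set ({0..int n + 1} - {int n div 2 + 1}))"
proof (rule eigenvalue_mset_distinct[OF staircase_mat_carrier])
  fix c assume c: "c \<in> {0..int n + 1} - {int n div 2 + 1}"
  show "eigenvalue (staircase_mat n (-1)) (of_int c)"
  proof (cases "2 * c \<le> int n")
    case True
    \<comment> \<open>\<open>G\<close> vanishes at the left end \<open>c - 1\<close>; the jump to
      zero at \<open>k = n + 1 - c\<close> is harmless because the factor
      \<open>n + 1 - k - c\<close> is zero there.\<close>
    let ?G = "\<lambda>j. if c - 1 \<le> j \<and> j \<le> int n - c then j - c + 1 else 0"
    have eq: "(int n + 1 - k - c) * (?G k - ?G (k - 1)) + (-1) * ?G (int n - k) = 0"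
      if "0 \<le> k" "k \<le> int n" for k
    proof -
      consider "c \<le> k \<and> k \<le> int n - c" | "k < c - 1" | "k = c - 1" | "k = int n + 1 - c" | "k > int n + 1 - c"
        by linarith
      then show ?thesis
        by cases (use that c True in \<open>auto simp: algebra_simps\<close>)
    qed
    show ?thesis
      by (rule eigenvalue_staircase[of ?G _ _ _ c, OF _ eq]) (use c True in auto)
  next
    case False
    define b where "b = int n + 1 - c"
    have b: "0 \<le> b" "2 * b < int n" "c = int n + 1 - b"
      using c False by (auto simp: b_def)
    \<comment> \<open>Mirror image: \<open>G\<close> vanishes at the right end \<open>n - b\<close>,
      and the jump sits at \<open>k = b\<close>, where the factor, now \<open>b - k\<close>, is
      zero.\<close>
    let ?G = "\<lambda>j. if b \<le> j \<and> j \<le> int n - b then j - (int n - b) else 0"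
    have eq: "(int n + 1 - k - (int n + 1 - b)) * (?G k - ?G (k - 1)) + (-1) * ?G (int n - k) = 0"
      if "0 \<le> k" "k \<le> int n" for k
    proof -
      consider "b < k \<and> k \<le> int n - b" | "k < b" | "k = b" | "k = int n + 1 - b" | "k > int n + 1 - b"
        by linarith
      then show ?thesis
        by cases (use that b in \<open>auto simp: algebra_simps\<close>)
    qed
    show ?thesis unfolding b(3)
      by (rule eigenvalue_staircase[of ?G _ _ _ b, OF _ eq]) (use b in auto)
  qed
next
  show "card ({0..int n + 1} - {int n div 2 + 1}) = n + 1"
    by (subst card_Diff_singleton) auto
qed simp

text \<open>For \<open>s = 2\<close> the same comparison of leading terms gives degree two. The two
  integers left out are those for which both truncated quadratics vanish identically.\<close>

lemma eigenvalue_mset_staircase_plus: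
  assumes "n \<ge> 1"
  shows "eigenvalue_mset (staircase_mat n 2)
    = image_mset of_int (mset_set (insert (2 * int n + 3)
        ({0..int n + 1} - {(int n + 1) div 2, (int n + 1) div 2 + 1} )))"
proof (rule eigenvalue_mset_distinct[OF staircase_mat_carrier])
  fix c assume c: "c \<in> insert (2 * int n + 3) ({0..int n + 1} - {(int n + 1) div 2, (int n + 1) div 2 + 1})"
  then consider "c = 2 * int n + 3" | "c \<ge> 0" "2 * c < int n" | "c \<le> int n + 1" "2 * c \<ge> int n + 4"
    by fastforce
  then show "eigenvalue (staircase_mat n 2) (of_int c)"
  proof cases
    case 1
    let ?G = "\<lambda>j. (j + 1) * (2 * int n + 2 - j)"
    show ?thesis unfolding 1
      by (rule eigenvalue_staircase[of ?G _ _ _ 0]) (auto simp: algebra_simps)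
  next
    case 2
    \<comment> \<open>Zero at \<open>c - 1\<close>, jump at \<open>k = n + 1 - c\<close> as before.
      At \<open>j = c\<close> the value is \<open>2 * (n - 2 * c)\<close>, nonzero since
      \<open>2 * c < n\<close>.\<close>
    let ?G = "\<lambda>j. if c - 1 \<le> j \<and> j \<le> int n - c then (j + 1 - c) * (2 * int n - c - 3 * j) else 0"
    have eq: "(int n + 1 - k - c) * (?G k - ?G (k - 1)) + 2 * ?G (int n - k) = 0"
      if "0 \<le> k" "k \<le> int n" for k
    proof -
      consider "c \<le> k \<and> k \<le> int n - c" | "k < c - 1" | "k = c - 1" | "k = int n + 1 - c" | "k > int n + 1 - c"
        by linarith
      then show ?thesis
        by cases (use that 2 in \<open>auto simp: algebra_simps\<close>)
    qed
    show ?thesis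
      by (rule eigenvalue_staircase[of ?G _ _ _ c, OF _ eq]) (use 2 in auto)
  next
    case 3
    define b where "b = int n + 1 - c"
    have b: "0 \<le> b" "2 * b + 2 \<le> int n" "c = int n + 1 - b"
      using 3 by (auto simp: b_def)
    \<comment> \<open>Zero at \<open>n - b\<close>, jump at \<open>k = b\<close>. At
      \<open>j = b\<close> the value is \<open>(n - 2 * b) * (n - 2 * b - 1)\<close>, nonzero since
      \<open>2 * b + 2 \<le> n\<close>.\<close>
    let ?G = "\<lambda>j. if b \<le> j \<and> j \<le> int n - b then (int n - b - j) * (int n + b - 1 - 3 * j) else 0"
    have eq: "(int n + 1 - k - (int n + 1 - b)) * (?G k - ?G (k - 1)) + 2 * ?G (int n - k) = 0"
      if "0 \<le> k" "k \<le> int n" for k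
    proof -
      consider "b < k \<and> k \<le> int n - b" | "k < b" | "k = b" | "k = int n + 1 - b" | "k > int n + 1 - b"
        by linarith
      then show ?thesis
        by cases (use that b in \<open>auto simp: algebra_simps\<close>)
    qed
    show ?thesis unfolding b(3)
      by (rule eigenvalue_staircase[of ?G _ _ _ b, OF _ eq]) (use b in auto)
  qed
next
  show "card (insert (2 * int n + 3) ({0..int n + 1} - {(int n + 1) div 2, (int n + 1) div 2 + 1})) = n + 1"
    using assms by (subst card_insert_disjoint) (auto simp: card_Diff_subset)
qed simp

section \<open>Incidences between vertices and lines\<close>

lemma SR_vertices_3:
  "SR_vertices 3 n = {[a, b, c] | a b c. 0 \<le> a \<and> 0 \<le> b \<and> 0 \<le> c \<and> a + b + c = int n}"
proof (rule Set.set_eqI)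
  fix x :: "int list"
  have "(\<exists>a b c. x = [a, b, c]) \<longleftrightarrow> length x = 3"
    by (auto simp: numeral_3_eq_3 length_Suc_conv)
  moreover have "[a, b, c] \<in> SR_vertices 3 n \<longleftrightarrow> 0 \<le> a \<and> 0 \<le> b \<and> 0 \<le> c \<and> a + b + c = int n" for a b c
    by (auto simp: SR_vertices_def numeral_3_eq_3 All_less_Suc)
  moreover have "x \<in> SR_vertices 3 n \<Longrightarrow> length x = 3"
    by (simp add: SR_vertices_def)
  ultimately show "x \<in> SR_vertices 3 n \<longleftrightarrow>
      x \<in> {[a, b, c] | a b c. 0 \<le> a \<and> 0 \<le> b \<and> 0 \<le> c \<and> a + b + c = int n}"
    by blast
qed

text \<open>The entry of the incidence matrix \<open>N\<close> at vertex \<open>v\<close> and line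
  \<open>x_i = k\<close>.\<close>

definition coord_ind :: "nat \<Rightarrow> nat \<Rightarrow> int list \<Rightarrow> complex" where
  "coord_ind i k v = of_bool (v ! i = int k)"

lemma SR_vertices_nth:
  assumes "v \<in> SR_vertices 3 n" "i < 3"
  shows "0 \<le> v ! i" "v ! i \<le> int n"
  using assms by (auto simp: SR_vertices_def)

lemma sum_coord_ind_mult:
  assumes "v \<in> SR_vertices 3 n" "w \<in> SR_vertices 3 n" "i < 3"
  shows "(\<Sum>k\<le>n. coord_ind i k v * coord_ind i k w) = of_bool (v ! i = w ! i)"
proof -
  have "(\<Sum>k\<le>n. coord_ind i k v * coord_ind i k w)
      = (\<Sum>k\<le>n. if k = nat (v ! i) then of_bool (v ! i = w ! i) else 0)"
    using SR_vertices_nth[OF assms(1,3)] by (intro sum.cong) (auto simp: coord_ind_def)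
  then show ?thesis
    using SR_vertices_nth[OF assms(1,3)] by (simp add: nat_le_iff)
qed

lemma sum_coord_ind:
  assumes "v \<in> SR_vertices 3 n" "i < 3"
  shows "(\<Sum>k\<le>n. coord_ind i k v) = 1"
proof -
  have "coord_ind i k v * coord_ind i k v = coord_ind i k v" for k
    by (simp add: coord_ind_def)
  then show ?thesis
    using sum_coord_ind_mult[OF assms(1,1,2)] by (simp only:) simp
qed

text \<open>Two coordinates determine the third, which is nonnegative exactly when
  \<open>k + l \<le> n\<close>. These are the entries of \<open>B\<close>.\<close>

lemma sum_vertices_coord_ind_two:
  assumes "i < 3" "j < 3" "i \<noteq> j"
  shows "(\<Sum>v\<in>SR_vertices 3 n. coord_ind i k v * coord_ind j l v) = of_bool (k + l \<le> n)"
proof -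
  let ?u = "map (\<lambda>t. if t = i then int k else if t = j then int l else int n - int k - int l) [0, 1, 2]"
  have "i = 0 \<or> i = 1 \<or> i = 2" "j = 0 \<or> j = 1 \<or> j = 2" using assms by auto
  then have *: "v \<in> SR_vertices 3 n \<and> v ! i = int k \<and> v ! j = int l \<longleftrightarrow> k + l \<le> n \<and> v = ?u" for v
    using assms(3) unfolding SR_vertices_3 by (elim disjE) (auto simp: numeral_2_eq_2)
  have "(\<Sum>v\<in>SR_vertices 3 n. coord_ind i k v * coord_ind j l v)
      = (\<Sum>v\<in>SR_vertices 3 n. of_bool (v ! i = int k \<and> v ! j = int l))"
    by (intro sum.cong) (auto simp: coord_ind_def)
  also have "\<dots> = of_nat (card {v \<in> SR_vertices 3 n. v ! i = int k \<and> v ! j = int l})"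
    by (simp add: finite_SR_vertices Int_def)
  also have "{v \<in> SR_vertices 3 n. v ! i = int k \<and> v ! j = int l} = (if k + l \<le> n then {?u} else {})"
    using * by (simp only: set_eq_iff) auto
  finally show ?thesis by simp
qed

lemma sum_vertices_coord_ind:
  assumes "i < 3" "k \<le> n"
  shows "(\<Sum>v\<in>SR_vertices 3 n. coord_ind i k v) = of_nat (n + 1 - k)"
proof -
  \<comment> \<open>Any second coordinate will do: each vertex has exactly one value of it, so
    inserting the sum over \<open>l\<close> changes nothing and reduces the count to pairs of
    lines.\<close>
  define j where "j = (if i = 0 then 1 else 0 :: nat)"
  have j: "j < 3" "i \<noteq> j" by (auto simp: j_def)
  have "(\<Sum>v\<in>SR_vertices 3 n. coord_ind i k v)
      = (\<Sum>v\<in>SR_vertices 3 n. \<Sum>l\<le>n. coord_ind i k v * coord_ind j l v)"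
    unfolding sum_distrib_left[symmetric] by (simp add: sum_coord_ind[OF _ j(1)])
  also have "\<dots> = (\<Sum>l\<le>n. of_bool (k + l \<le> n))"
    using assms(1) j by (subst sum.swap) (simp add: sum_vertices_coord_ind_two)
  also have "\<dots> = of_nat (card {l. l \<le> n \<and> k + l \<le> n})"
    by (simp add: Int_def)
  also have "{l. l \<le> n \<and> k + l \<le> n} = {..<n + 1 - k}"
    using assms(2) by auto
  finally show ?thesis by simp
qed

lemma card_SR_vertices_3: "2 * card (SR_vertices 3 n) = (n + 1) * (n + 2)"
proof -
  \<comment> \<open>Each vertex lies on exactly one line \<open>x_0 = k\<close>, so the vertices are
    counted line by line.\<close>
  have "complex_of_nat (card (SR_vertices 3 n)) = (\<Sum>v\<in>SR_vertices 3 n. \<Sum>k\<le>n. coord_ind 0 k v)"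
    using sum_coord_ind[of _ n 0] by simp
  also have "\<dots> = (\<Sum>k\<le>n. of_nat (n + 1 - k))"
    by (subst sum.swap) (simp add: sum_vertices_coord_ind)
  finally have "card (SR_vertices 3 n) = (\<Sum>k\<le>n. n + 1 - k)"
    unfolding of_nat_sum[symmetric] of_nat_eq_iff .
  also have "\<dots> = (\<Sum>k\<le>n. k + 1)"
    by (rule sum.reindex_bij_witness[of _ "\<lambda>k. n - k" "\<lambda>k. n - k"]) auto
  also have "2 * \<dots> = (n + 1) * (n + 2)"
    by (induction n) auto
  finally show ?thesis .
qed

text \<open>As the coordinate sum is fixed, vertices agreeing in two places agree in all three.
  Hence the number of agreements is 0, 1 or 3, and 1 means adjacency. This is
  \<open>A + 3I = NN\<^sup>T\<close> entrywise.\<close>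

lemma SR_adj_3:
  assumes "v \<in> SR_vertices 3 n" "w \<in> SR_vertices 3 n"
  shows "(\<Sum>i<3. of_bool (v ! i = w ! i)) = (of_bool (SR_adj 3 v w) + 3 * of_bool (v = w) :: complex)"
proof -
  have "card {i. i < 3 \<and> v ! i \<noteq> w ! i} = (\<Sum>i<3. of_bool (v ! i \<noteq> w ! i))"
    by (simp add: Int_def)
  then show ?thesis
    using assms unfolding SR_adj_def SR_vertices_3
    by (auto simp: numeral_3_eq_3 split: if_splits)
qed

text \<open>The line \<open>x_i = v_i\<close> has \<open>n + 1 - v_i\<close> vertices. The sum over
  \<open>i\<close> is \<open>2n + 3\<close>, in which \<open>v\<close> itself is counted three
  times.\<close>

lemma SR_3_regular:
  assumes v: "v \<in> SR_vertices 3 n"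
  shows "card {w \<in> SR_vertices 3 n. SR_adj 3 v w} = 2 * n"
proof -
  have "complex_of_nat (card {w \<in> SR_vertices 3 n. SR_adj 3 v w})
      = (\<Sum>w\<in>SR_vertices 3 n. of_bool (SR_adj 3 v w))"
    by (simp add: finite_SR_vertices Int_def)
  also have "\<dots> = (\<Sum>w\<in>SR_vertices 3 n. (\<Sum>i<3. of_bool (v ! i = w ! i)) - 3 * of_bool (v = w))"
    by (intro sum.cong) (simp_all only: SR_adj_3[OF v] add_diff_cancel_right')
  also have "\<dots> = (\<Sum>w\<in>SR_vertices 3 n. \<Sum>i<3. coord_ind i (nat (v ! i)) w) - 3"
    unfolding sum_subtractf
    using SR_vertices_nth[OF v] v
    by (intro arg_cong2[of _ _ _ _ "(-)"] sum.cong)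
      (auto simp: coord_ind_def finite_SR_vertices of_bool_def sum_distrib_left[symmetric])
  also have "\<dots> = (\<Sum>i<3. of_nat (n + 1 - nat (v ! i))) - 3"
    using SR_vertices_nth[OF v]
    by (subst sum.swap) (simp add: sum_vertices_coord_ind nat_le_iff)
  also have "\<dots> = of_nat (2 * n)"
  proof -
    have "(\<Sum>i<3. n + 1 - nat (v ! i)) = 2 * n + 3"
      using v unfolding SR_vertices_3 by (auto simp: numeral_3_eq_3 numeral_2_eq_2)
    then have "(\<Sum>i<3. complex_of_nat (n + 1 - nat (v ! i))) = of_nat (2 * n + 3)"
      unfolding of_nat_sum[symmetric] by (rule arg_cong)
    then show ?thesis by simp
  qed
  finally show ?thesis unfolding of_nat_eq_iff .
qed

section \<open>Factorisation of \<open>A + 3I\<close> and the block triangular form\<close>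

lemma sum_lessThan_add:
  fixes f :: "nat \<Rightarrow> 'a :: comm_monoid_add"
  shows "(\<Sum>i<m + n. f i) = (\<Sum>i<m. f i) + (\<Sum>i<n. f (m + i))"
  by (induction n) (auto simp: add.assoc)

lemma sum_lessThan_3: "(\<Sum>i<3. f i) = f 0 + f 1 + f (2 :: nat)"
  by (simp add: numeral_3_eq_3 numeral_2_eq_2)

lemma sum_nth_distinct: "distinct xs \<Longrightarrow> (\<Sum>i<length xs. f (xs ! i)) = (\<Sum>x\<in>set xs. f x)"
  by (simp add: sum.distinct_set_conv_list sum_list_sum_nth atLeast0LessThan)

text \<open>With \<open>N\<^sub>i\<close> the incidence matrix of the vertices against the lines \<open>x\<^sub>i = k\<close>, these are the entries of
  \<open>[N\<^sub>0 + N\<^sub>1 + N\<^sub>2, N\<^sub>1, N\<^sub>2]\<close> and of \<open>[N\<^sub>0, N\<^sub>1 - N\<^sub>0, N\<^sub>2 - N\<^sub>0]\<^sup>T\<close>. This change of basis leaves \<open>NN\<^sup>T\<close>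
  unchanged and makes \<open>N\<^sup>TN\<close> block triangular.\<close>

definition line_cols :: "nat \<Rightarrow> nat \<Rightarrow> int list \<Rightarrow> complex" where
  "line_cols q b v =
    (if b < q then coord_ind 0 b v + coord_ind 1 b v + coord_ind 2 b v
     else if b < q + q then coord_ind 1 (b - q) v else coord_ind 2 (b - q - q) v)"

definition line_rows :: "nat \<Rightarrow> nat \<Rightarrow> int list \<Rightarrow> complex" where
  "line_rows q a v =
    (if a < q then coord_ind 0 a v
     else if a < q + q then coord_ind 1 (a - q) v - coord_ind 0 (a - q) v
     else coord_ind 2 (a - q - q) v - coord_ind 0 (a - q - q) v)"

text \<open>The mixed products of \<open>coord_ind 1\<close> or \<open>coord_ind 2\<close> at
  \<open>v\<close> with \<open>coord_ind 0\<close> at \<open>w\<close> cancel between the first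
  block and the other two.\<close>

lemma sum_line_cols_rows:
  assumes "v \<in> SR_vertices 3 n" "w \<in> SR_vertices 3 n" and q: "q = n + 1"
  shows "(\<Sum>a<q + (q + q). line_cols q a v * line_rows q a w)
    = of_bool (SR_adj 3 v w) + 3 * of_bool (v = w)"
proof -
  have "(\<Sum>a<q + (q + q). line_cols q a v * line_rows q a w)
      = (\<Sum>k<q. coord_ind 0 k v * coord_ind 0 k w) + (\<Sum>k<q. coord_ind 1 k v * coord_ind 1 k w)
        + (\<Sum>k<q. coord_ind 2 k v * coord_ind 2 k w)"
    unfolding sum_lessThan_add sum.distrib[symmetric]
    by (intro sum.cong) (auto simp: line_cols_def line_rows_def algebra_simps)
  also have "{..<q} = {..n}" using q by auto
  also have "(\<Sum>k\<le>n. coord_ind 0 k v * coord_ind 0 k w) + (\<Sum>k\<le>n. coord_ind 1 k v * coord_ind 1 k w)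
        + (\<Sum>k\<le>n. coord_ind 2 k v * coord_ind 2 k w) = (\<Sum>i<3. of_bool (v ! i = w ! i))"
    using sum_coord_ind_mult[OF assms(1,2)] by (simp add: sum_lessThan_3 del: sum_of_bool_eq)
  finally show ?thesis by (simp only: SR_adj_3[OF assms(1,2)])
qed

lemma sum_vertices_coord_ind_mult:
  assumes "i < 3" "j < 3" "k \<le> n" "l \<le> n"
  shows "(\<Sum>v\<in>SR_vertices 3 n. coord_ind i k v * coord_ind j l v)
    = (if i = j then if k = l then of_nat (n + 1 - k) else 0 else of_bool (k + l \<le> n))"
proof (cases "i = j")
  case True
  have "coord_ind i k v * coord_ind i l v = (if k = l then coord_ind i k v else 0)" for v
    by (simp add: coord_ind_def)
  with True assms show ?thesis by (simp add: sum_vertices_coord_ind)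
qed (use assms in \<open>simp add: sum_vertices_coord_ind_two\<close>)

definition line_cols_mat :: "nat \<Rightarrow> int list list \<Rightarrow> complex mat" where
  "line_cols_mat q vs = mat (length vs) (q + (q + q)) (\<lambda>(i, b). line_cols q b (vs ! i))"

definition line_rows_mat :: "nat \<Rightarrow> int list list \<Rightarrow> complex mat" where
  "line_rows_mat q vs = mat (q + (q + q)) (length vs) (\<lambda>(a, i). line_rows q a (vs ! i))"

lemma line_mat_carrier:
  "line_cols_mat q vs \<in> carrier_mat (length vs) (q + (q + q))"
  "line_rows_mat q vs \<in> carrier_mat (q + (q + q)) (length vs)"
  by (simp_all add: line_cols_mat_def line_rows_mat_def)

text \<open>The scalar \<open>1\<close> gives the right-hand side the shape of
  \<open>eigenvalue_mset_affine\<close>.\<close>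

lemma adjacency_matrix_SR_3:
  assumes vs: "distinct vs" "set vs = SR_vertices 3 n" and q: "q = n + 1"
  shows "adjacency_matrix (SR_adj 3) vs
    = (-3) \<cdot>\<^sub>m 1\<^sub>m (length vs) + 1 \<cdot>\<^sub>m (line_cols_mat q vs * line_rows_mat q vs)"
proof (rule eq_matI)
  fix i j assume "i < dim_row ((-3) \<cdot>\<^sub>m 1\<^sub>m (length vs) + 1 \<cdot>\<^sub>m (line_cols_mat q vs * line_rows_mat q vs))"
    "j < dim_col ((-3) \<cdot>\<^sub>m 1\<^sub>m (length vs) + 1 \<cdot>\<^sub>m (line_cols_mat q vs * line_rows_mat q vs))"
  then have ij: "i < length vs" "j < length vs"
    by (simp_all add: line_cols_mat_def line_rows_mat_def)
  then have "vs ! i \<in> SR_vertices 3 n" "vs ! j \<in> SR_vertices 3 n"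
    using vs(2) nth_mem by blast+
  then have "(line_cols_mat q vs * line_rows_mat q vs) $$ (i, j)
      = of_bool (SR_adj 3 (vs ! i) (vs ! j)) + 3 * of_bool (i = j)"
    using ij sum_line_cols_rows[of "vs ! i" n "vs ! j" q] q nth_eq_iff_index_eq[OF vs(1) ij]
    by (simp add: line_cols_mat_def line_rows_mat_def scalar_prod_def atLeast0LessThan)
  then show "adjacency_matrix (SR_adj 3) vs $$ (i, j)
      = ((-3) \<cdot>\<^sub>m 1\<^sub>m (length vs) + 1 \<cdot>\<^sub>m (line_cols_mat q vs * line_rows_mat q vs)) $$ (i, j)"
    using ij by (simp add: adjacency_matrix_def line_cols_mat_def line_rows_mat_def)
qed (simp_all add: adjacency_matrix_def line_cols_mat_def line_rows_mat_def)

text \<open>Here \<open>N\<^sub>i\<^sup>TN\<^sub>i = D\<close> and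
  \<open>N\<^sub>i\<^sup>TN\<^sub>j = B\<close> for distinct \<open>i\<close>, \<open>j\<close>. The
  first block column is \<open>D + 2B\<close> above \<open>(D + 2B) - (D + 2B) = 0\<close>; the
  remaining lower blocks are \<open>D - B\<close> on the diagonal and \<open>B - B = 0\<close> off
  it.\<close>

lemma sum_vertices_rows_cols:
  assumes q: "q = n + 1"
  shows "a < q \<Longrightarrow> b < q \<Longrightarrow>
      (\<Sum>v\<in>SR_vertices 3 n. line_rows q a v * line_cols q b v) = staircase_mat n 2 $$ (a, b)"
    and "a < q + q \<Longrightarrow> b < q \<Longrightarrow>
      (\<Sum>v\<in>SR_vertices 3 n. line_rows q (q + a) v * line_cols q b v) = 0"
    and "a < q \<Longrightarrow> b < q \<Longrightarrow>
      (\<Sum>v\<in>SR_vertices 3 n. line_rows q (q + a) v * line_cols q (q + b) v) = staircase_mat n (-1) $$ (a, b)"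
    and "a < q \<Longrightarrow> b < q \<Longrightarrow>
      (\<Sum>v\<in>SR_vertices 3 n. line_rows q (q + a) v * line_cols q (q + (q + b)) v) = 0"
    and "a < q \<Longrightarrow> b < q \<Longrightarrow>
      (\<Sum>v\<in>SR_vertices 3 n. line_rows q (q + (q + a)) v * line_cols q (q + b) v) = 0"
    and "a < q \<Longrightarrow> b < q \<Longrightarrow>
      (\<Sum>v\<in>SR_vertices 3 n. line_rows q (q + (q + a)) v * line_cols q (q + (q + b)) v)
        = staircase_mat n (-1) $$ (a, b)"
proof -
  have entry: "(\<Sum>v\<in>SR_vertices 3 n. coord_ind i k v * coord_ind j l v)
      = (if i = j then if k = l then of_nat (n + 1 - k) else 0 else of_bool (k + l \<le> n))"
    if "i < 3" "j < 3" "k < q" "l < q" for i j k l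
    using sum_vertices_coord_ind_mult[of i j k n l] that by (simp add: q)
  have st_entry: "staircase_mat n s $$ (k, l)
      = (if k = l then of_nat (n + 1 - k) else 0) + (if k + l \<le> n then of_int s else 0)"
    if "k < q" "l < q" for k l s
    using that by (simp add: staircase_mat_def q)
  note simps = line_rows_def line_cols_def st_entry ring_distribs sum.distrib sum_subtractf entry
  show "a < q \<Longrightarrow> b < q \<Longrightarrow>
      (\<Sum>v\<in>SR_vertices 3 n. line_rows q a v * line_cols q b v) = staircase_mat n 2 $$ (a, b)"
    by (simp add: simps)
  show "a < q + q \<Longrightarrow> b < q \<Longrightarrow>
      (\<Sum>v\<in>SR_vertices 3 n. line_rows q (q + a) v * line_cols q b v) = 0"
    by (cases "a < q") (simp_all add: simps)
  show "a < q \<Longrightarrow> b < q \<Longrightarrow>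
      (\<Sum>v\<in>SR_vertices 3 n. line_rows q (q + a) v * line_cols q (q + b) v) = staircase_mat n (-1) $$ (a, b)"
    by (simp add: simps)
  show "a < q \<Longrightarrow> b < q \<Longrightarrow>
      (\<Sum>v\<in>SR_vertices 3 n. line_rows q (q + a) v * line_cols q (q + (q + b)) v) = 0"
    by (simp add: simps)
  show "a < q \<Longrightarrow> b < q \<Longrightarrow>
      (\<Sum>v\<in>SR_vertices 3 n. line_rows q (q + (q + a)) v * line_cols q (q + b) v) = 0"
    by (simp add: simps)
  show "a < q \<Longrightarrow> b < q \<Longrightarrow>
      (\<Sum>v\<in>SR_vertices 3 n. line_rows q (q + (q + a)) v * line_cols q (q + (q + b)) v)
        = staircase_mat n (-1) $$ (a, b)"
    by (simp add: simps)
qed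

text \<open>The block \<open>C\<close> stays abstract: the spectrum of a block triangular matrix
  depends on its diagonal blocks only.\<close>

lemma line_rows_mat_mult_line_cols_mat:
  assumes vs: "distinct vs" "set vs = SR_vertices 3 n" and q: "q = n + 1"
  obtains C where "C \<in> carrier_mat q (q + q)"
    "line_rows_mat q vs * line_cols_mat q vs = four_block_mat (staircase_mat n 2) C (0\<^sub>m (q + q) q)
      (four_block_mat (staircase_mat n (-1)) (0\<^sub>m q q) (0\<^sub>m q q) (staircase_mat n (-1)))"
proof
  let ?s = "\<lambda>a b. \<Sum>v\<in>SR_vertices 3 n. line_rows q a v * line_cols q b v"
  let ?C = "mat q (q + q) (\<lambda>(a, b). ?s a (q + b))"
  let ?D = "four_block_mat (staircase_mat n (-1)) (0\<^sub>m q q) (0\<^sub>m q q) (staircase_mat n (-1))"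
  let ?W = "four_block_mat (staircase_mat n 2) ?C (0\<^sub>m (q + q) q) ?D"
  show "?C \<in> carrier_mat q (q + q)" by simp
  have st: "dim_row (staircase_mat n s) = q" "dim_col (staircase_mat n s) = q" for s
    by (simp_all add: staircase_mat_def q)
  show "line_rows_mat q vs * line_cols_mat q vs = ?W"
  proof (rule eq_matI)
    fix a b assume "a < dim_row ?W" "b < dim_col ?W"
    then have ab: "a < q + (q + q)" "b < q + (q + q)" by (simp_all add: st)
    have D: "?D $$ (k, l) = ?s (q + k) (q + l)" if kl: "k < q + q" "l < q + q" for k l
    proof -
      have "k < q \<or> (\<exists>k'<q. k = q + k')" "l < q \<or> (\<exists>l'<q. l = q + l')"
        using kl by (metis add_diff_inverse_nat nat_add_left_cancel_less)+
      then show ?thesis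
        using sum_vertices_rows_cols(3-6)[OF q] by (elim disjE exE conjE) (simp_all add: st)
    qed
    have "(line_rows_mat q vs * line_cols_mat q vs) $$ (a, b) = ?s a b"
      using ab sum_nth_distinct[OF vs(1), of "\<lambda>v. line_rows q a v * line_cols q b v"] vs(2)
      by (simp add: line_cols_mat_def line_rows_mat_def scalar_prod_def atLeast0LessThan)
    also have "\<dots> = ?W $$ (a, b)"
    proof -
      have "a < q \<or> (\<exists>k<q + q. a = q + k)" "b < q \<or> (\<exists>l<q + q. b = q + l)"
        using ab by (metis add_diff_inverse_nat nat_add_left_cancel_less)+
      then consider "a < q" "b < q" | l where "a < q" "l < q + q" "b = q + l"
        | k where "k < q + q" "a = q + k" "b < q"
        | k l where "k < q + q" "a = q + k" "l < q + q" "b = q + l" by blast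
      then show ?thesis
      proof cases
        case 1
        then show ?thesis using sum_vertices_rows_cols(1)[OF q] by (simp add: st)
      next
        case 2
        then show ?thesis by (simp add: st)
      next
        case 3
        then show ?thesis using sum_vertices_rows_cols(2)[OF q] by (simp add: st)
      next
        case 4
        then have "?W $$ (a, b) = ?D $$ (k, l)"
          by (subst index_mat_four_block(1)) (simp_all add: st)
        with 4 show ?thesis by (simp only: D)
      qed
    qed
    finally show "(line_rows_mat q vs * line_cols_mat q vs) $$ (a, b) = ?W $$ (a, b)" .
  qed (simp_all add: line_cols_mat_def line_rows_mat_def st)
qed

section \<open>From the line spectrum to the spectra of \<open>A\<close> and
  \<open>L\<close>\<close>

text \<open>The spectrum of \<open>N\<^sup>TN - 3I\<close>.\<close>

definition line_spectrum :: "nat \<Rightarrow> int multiset" where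
  "line_spectrum n =
    mset_set (insert (2 * int n) ({-3..int n - 2} - {(int n + 1) div 2 - 3, (int n + 1) div 2 - 2}))
    + repeat_mset 2 (mset_set ({-3..int n - 2} - {int n div 2 - 2}))"

text \<open>The condition on \<open>U\<close> pads both sides with copies of \<open>-3\<close> since
  either of the two sizes can be larger: there are fewer vertices than lines when
  \<open>n < 4\<close>.\<close>

lemma eigenvalue_mset_SR_3:
  fixes U :: "int multiset"
  assumes n: "n \<ge> 1" and vs: "distinct vs" "set vs = SR_vertices 3 n"
    and U: "U + replicate_mset (3 * (n + 1)) (-3) =
      line_spectrum n + replicate_mset ((n + 1) * (n + 2) div 2) (-3)"
  shows "eigenvalue_mset (adjacency_matrix (SR_adj 3) vs) = image_mset of_int U"
proof -
  define q where "q = n + 1"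
  let ?p = "length vs"
  let ?N = "line_cols_mat q vs"
  let ?M = "line_rows_mat q vs"
  let ?h = "\<lambda>k. (-3) + 1 * k :: complex"
  define S where "S = insert (2 * int n + 3) ({0..int n + 1} - {(int n + 1) div 2, (int n + 1) div 2 + 1})"
  define T where "T = {0..int n + 1} - {int n div 2 + 1}"
  obtain C where C: "C \<in> carrier_mat q (q + q)"
    and MN: "?M * ?N = four_block_mat (staircase_mat n 2) C (0\<^sub>m (q + q) q)
      (four_block_mat (staircase_mat n (-1)) (0\<^sub>m q q) (0\<^sub>m q q) (staircase_mat n (-1)))"
    using line_rows_mat_mult_line_cols_mat[OF vs q_def] .
  have st: "staircase_mat n s \<in> carrier_mat q q" for s
    unfolding q_def by (rule staircase_mat_carrier)
  have "eigenvalue_mset (?M * ?N) = image_mset of_int (mset_set S) +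
      (image_mset of_int (mset_set T) + image_mset of_int (mset_set T))"
    using C st n unfolding MN S_def T_def
    by (simp only: eigenvalue_mset_block_triangular[of _ q _ "q + q"] four_block_carrier_mat zero_carrier_mat
        eigenvalue_mset_block_triangular[of _ q _ q]
        eigenvalue_mset_staircase_minus eigenvalue_mset_staircase_plus)
  then have MN_mset: "eigenvalue_mset (?M * ?N) = image_mset of_int (mset_set S + repeat_mset 2 (mset_set T))"
    by (simp add: numeral_2_eq_2)
  have shift: "(\<lambda>k. k - 3) ` X = {x. x + 3 \<in> X}" for X :: "int set"
    by (force simp: image_iff)
  \<comment> \<open>Subtracting 3 turns the spectrum of \<open>A + 3I\<close> into that of
    \<open>A\<close> and the padding zeros into \<open>-3\<close>.\<close>
  have "image_mset ?h (eigenvalue_mset (?N * ?M) + replicate_mset (q + (q + q)) 0)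
      = image_mset ?h (eigenvalue_mset (?M * ?N) + replicate_mset ?p 0)"
    using eigenvalue_mset_mult_commute[OF line_mat_carrier] by (rule arg_cong)
  then have "image_mset ?h (eigenvalue_mset (?N * ?M)) + replicate_mset (q + (q + q)) (-3)
      = image_mset of_int (image_mset (\<lambda>k. k - 3) (mset_set S + repeat_mset 2 (mset_set T))) + replicate_mset ?p (-3)"
    unfolding MN_mset by (simp add: image_mset.compositionality o_def)
  also have "image_mset (\<lambda>k. k - 3) (mset_set S + repeat_mset 2 (mset_set T))
      = mset_set ((\<lambda>k. k - 3) ` S) + repeat_mset 2 (mset_set ((\<lambda>k. k - 3) ` T))"
    by (simp add: image_mset_mset_set[symmetric] inj_on_def numeral_2_eq_2)
  also have "(\<lambda>k. k - 3) ` S = insert (2 * int n) ({-3..int n - 2} - {(int n + 1) div 2 - 3, (int n + 1) div 2 - 2})"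
    unfolding shift S_def by auto
  also have "(\<lambda>k. k - 3) ` T = {-3..int n - 2} - {int n div 2 - 2}"
    unfolding shift T_def by auto
  also have "?p = (n + 1) * (n + 2) div 2"
    using card_SR_vertices_3[of n] distinct_card[OF vs(1)] vs(2) by simp
  also have "q + (q + q) = 3 * (n + 1)"
    by (simp add: q_def)
  finally have "image_mset ?h (eigenvalue_mset (?N * ?M)) + replicate_mset (3 * (n + 1)) (-3)
      = image_mset of_int (U + replicate_mset (3 * (n + 1)) (-3))"
    unfolding U line_spectrum_def by simp
  then have "image_mset ?h (eigenvalue_mset (?N * ?M)) = image_mset of_int U"
    by simp
  moreover have "?N * ?M \<in> carrier_mat ?p ?p"
    using line_mat_carrier mult_carrier_mat by blast
  ultimately show ?thesis
    unfolding adjacency_matrix_SR_3[OF vs q_def] by (simp only: eigenvalue_mset_affine)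
qed

text \<open>By regularity the degree matrix is \<open>2n\<close> times the identity.\<close>

lemma laplacian_matrix_SR_3:
  assumes vs: "distinct vs" "set vs = SR_vertices 3 n"
  shows "laplacian_matrix (SR_adj 3) vs
    = (2 * of_nat n) \<cdot>\<^sub>m 1\<^sub>m (length vs) + (-1) \<cdot>\<^sub>m adjacency_matrix (SR_adj 3) vs"
proof -
  have "card {w \<in> SR_vertices 3 n. SR_adj 3 (vs ! i) w} = 2 * n" if "i < length vs" for i
    using SR_3_regular vs(2) nth_mem[OF that] by blast
  then show ?thesis
    unfolding laplacian_matrix_def degree_matrix_def adjacency_matrix_def vs(2)
    by (intro eq_matI) auto
qed

section \<open>Matching the multiplicities with the closed forms\<close>

lemma count_sum_replicate_mset:
  assumes "finite S"
  shows "count (\<Sum>k\<in>S. replicate_mset c k) x = (if x \<in> S then c else 0)"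
  using assms by (simp add: count_sum)

lemma count_image_mset_diff: "count (image_mset (\<lambda>k. c - k) X) x = count X (c - x :: int)"
  by (induction X) auto

text \<open>This verifies the condition of \<open>eigenvalue_mset_SR_3\<close>. Of the three
  intervals in \<open>line_spectrum n\<close>, all omit \<open>m - 2\<close> and one omits
  \<open>m - 1\<close>, whence the gap and the multiplicity 2.\<close>

lemma SR_3_multiplicities_odd:
  fixes U :: "int multiset"
  assumes n: "n = 2 * m + 1"
    and U: "U = replicate_mset (2 * m choose 2) (-3)
             + (\<Sum>k\<in>{-2..int m - 3}. replicate_mset 3 k)
             + replicate_mset 2 (int m - 1)
             + (\<Sum>k\<in>{int m..2 * int m - 1}. replicate_mset 3 k)
             + replicate_mset 1 (4 * int m + 2)"
  shows "U + replicate_mset (3 * (n + 1)) (-3) =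
      line_spectrum n + replicate_mset ((n + 1) * (n + 2) div 2) (-3)"
    and "image_mset (\<lambda>k. 2 * int n - k) U = replicate_mset (2 * m choose 2) (4 * int m + 5)
             + (\<Sum>k\<in>{3 * int m + 5..4 * int m + 4}. replicate_mset 3 k)
             + replicate_mset 2 (3 * int m + 3)
             + (\<Sum>k\<in>{2 * int m + 3..3 * int m + 2}. replicate_mset 3 k)
             + replicate_mset 1 0"
proof -
  have half: "(int n + 1) div 2 = int m + 1" "int n div 2 = int m"
    using n by auto
  have "even (2 * m * (2 * m - 1))" by simp
  then have "2 * (2 * m choose 2) = 2 * m * (2 * m - 1)"
    unfolding choose_two by (rule dvd_mult_div_cancel)
  moreover have "2 * ((n + 1) * (n + 2) div 2) = (n + 1) * (n + 2)"
    by simp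
  \<comment> \<open>The case split on \<open>m\<close> deals with the truncated subtraction.\<close>
  moreover have "2 * m * (2 * m - 1) + 6 * (n + 1) = (n + 1) * (n + 2) + 6"
    using n by (cases m) (auto simp: algebra_simps)
  \<comment> \<open>The 3 on the right counts the occurrences of \<open>-3\<close> in
    \<open>line_spectrum n\<close>.\<close>
  ultimately have mult: "(2 * m choose 2) + 3 * (n + 1) = (n + 1) * (n + 2) div 2 + 3"
    by linarith
  show "U + replicate_mset (3 * (n + 1)) (-3) =
      line_spectrum n + replicate_mset ((n + 1) * (n + 2) div 2) (-3)"
  proof (rule multiset_eqI)
    fix x :: int
    consider "x = -3" | "x \<noteq> -3" by blast
    then show "count (U + replicate_mset (3 * (n + 1)) (-3)) x = count
      (line_spectrum n + replicate_mset ((n + 1) * (n + 2) div 2) (-3)) x"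
      unfolding line_spectrum_def half U count_union count_sum_replicate_mset[OF finite_atLeastAtMost_int]
        count_replicate_mset count_repeat_mset count_mset_set'
      using mult n by cases auto
  qed
  show "image_mset (\<lambda>k. 2 * int n - k) U = replicate_mset (2 * m choose 2) (4 * int m + 5)
             + (\<Sum>k\<in>{3 * int m + 5..4 * int m + 4}. replicate_mset 3 k)
             + replicate_mset 2 (3 * int m + 3)
             + (\<Sum>k\<in>{2 * int m + 3..3 * int m + 2}. replicate_mset 3 k)
             + replicate_mset 1 0"
    unfolding U by (rule multiset_eqI)
      (simp only: count_image_mset_diff count_union count_sum_replicate_mset[OF finite_atLeastAtMost_int]
        count_replicate_mset, use n in auto)
qed

text \<open>Now all three intervals omit \<open>m - 2\<close> and one omits \<open>m - 3\<close>. As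
  \<open>m \<ge> 1\<close>, both lie above \<open>-3\<close>, which therefore still occurs three
  times.\<close>

lemma SR_3_multiplicities_even:
  fixes U :: "int multiset"
  assumes n: "n = 2 * m" "n \<ge> 1"
    and U: "U = replicate_mset ((2 * m - 1) choose 2) (-3)
             + (\<Sum>k\<in>{-2..int m - 4}. replicate_mset 3 k)
             + replicate_mset 2 (int m - 3)
             + (\<Sum>k\<in>{int m - 1..2 * int m - 2}. replicate_mset 3 k)
             + replicate_mset 1 (4 * int m)"
  shows "U + replicate_mset (3 * (n + 1)) (-3) =
      line_spectrum n + replicate_mset ((n + 1) * (n + 2) div 2) (-3)"
    and "image_mset (\<lambda>k. 2 * int n - k) U = replicate_mset ((2 * m - 1) choose 2) (4 * int m + 3)
             + (\<Sum>k\<in>{3 * int m + 4..4 * int m + 2}. replicate_mset 3 k)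
             + replicate_mset 2 (3 * int m + 3)
             + (\<Sum>k\<in>{2 * int m + 2..3 * int m + 1}. replicate_mset 3 k)
             + replicate_mset 1 0"
proof -
  have half: "(int n + 1) div 2 = int m" "int n div 2 = int m"
    using n by auto
  have "even ((2 * m - 1) * (2 * m - 1 - 1))" by simp
  then have "2 * ((2 * m - 1) choose 2) = (2 * m - 1) * (2 * m - 1 - 1)"
    unfolding choose_two by (rule dvd_mult_div_cancel)
  moreover have "2 * ((n + 1) * (n + 2) div 2) = (n + 1) * (n + 2)"
    by simp
  moreover have "(2 * m - 1) * (2 * m - 1 - 1) + 6 * (n + 1) = (n + 1) * (n + 2) + 6"
    using n by (cases m) (auto simp: algebra_simps)
  ultimately have mult: "((2 * m - 1) choose 2) + 3 * (n + 1) = (n + 1) * (n + 2) div 2 + 3"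
    by linarith
  show "U + replicate_mset (3 * (n + 1)) (-3) =
      line_spectrum n + replicate_mset ((n + 1) * (n + 2) div 2) (-3)"
  proof (rule multiset_eqI)
    fix x :: int
    consider "x = -3" | "x \<noteq> -3" by blast
    then show "count (U + replicate_mset (3 * (n + 1)) (-3)) x = count
      (line_spectrum n + replicate_mset ((n + 1) * (n + 2) div 2) (-3)) x"
      unfolding line_spectrum_def half U count_union count_sum_replicate_mset[OF finite_atLeastAtMost_int]
        count_replicate_mset count_repeat_mset count_mset_set'
      using mult n by cases auto
  qed
  show "image_mset (\<lambda>k. 2 * int n - k) U = replicate_mset ((2 * m - 1) choose 2) (4 * int m + 3)
             + (\<Sum>k\<in>{3 * int m + 4..4 * int m + 2}. replicate_mset 3 k)
             + replicate_mset 2 (3 * int m + 3)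
             + (\<Sum>k\<in>{2 * int m + 2..3 * int m + 1}. replicate_mset 3 k)
             + replicate_mset 1 0"
    unfolding U by (rule multiset_eqI)
      (simp only: count_image_mset_diff count_union count_sum_replicate_mset[OF finite_atLeastAtMost_int]
        count_replicate_mset, use n in auto)
qed

theorem theorem1p1:
  fixes n :: nat and vs :: "int list list" and A L :: "complex mat"
  assumes n: "n \<ge> 1"
    and vs: "distinct vs" "set vs = SR_vertices 3 n"
    and A: "A = adjacency_matrix (SR_adj 3) vs"
    and L: "L = laplacian_matrix (SR_adj 3) vs"
  shows "integral_graph (SR_adj 3) vs
    \<and> laplacian_integral_graph (SR_adj 3) vs
    \<and> eigenvalue_mset L = image_mset (\<lambda>k. 2 * of_nat n - k) (eigenvalue_mset A)
    \<and> (\<forall>m. n = 2 * m + 1 \<longrightarrow>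
          eigenvalue_mset A = image_mset of_int
            (replicate_mset (2 * m choose 2) (-3)
             + (\<Sum>k\<in>{-2..int m - 3}. replicate_mset 3 k)
             + replicate_mset 2 (int m - 1)
             + (\<Sum>k\<in>{int m..2 * int m - 1}. replicate_mset 3 k)
             + replicate_mset 1 (4 * int m + 2))
        \<and> eigenvalue_mset L = image_mset of_int
            (replicate_mset (2 * m choose 2) (4 * int m + 5)
             + (\<Sum>k\<in>{3 * int m + 5..4 * int m + 4}. replicate_mset 3 k)
             + replicate_mset 2 (3 * int m + 3)
             + (\<Sum>k\<in>{2 * int m + 3..3 * int m + 2}. replicate_mset 3 k)
             + replicate_mset 1 0))
    \<and> (\<forall>m. n = 2 * m \<longrightarrow>
          eigenvalue_mset A = image_mset of_int
            (replicate_mset ((2 * m - 1) choose 2) (-3)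
             + (\<Sum>k\<in>{-2..int m - 4}. replicate_mset 3 k)
             + replicate_mset 2 (int m - 3)
             + (\<Sum>k\<in>{int m - 1..2 * int m - 2}. replicate_mset 3 k)
             + replicate_mset 1 (4 * int m))
        \<and> eigenvalue_mset L = image_mset of_int
            (replicate_mset ((2 * m - 1) choose 2) (4 * int m + 3)
             + (\<Sum>k\<in>{3 * int m + 4..4 * int m + 2}. replicate_mset 3 k)
             + replicate_mset 2 (3 * int m + 3)
             + (\<Sum>k\<in>{2 * int m + 2..3 * int m + 1}. replicate_mset 3 k)
             + replicate_mset 1 0))"
proof -
  have Ac: "A \<in> carrier_mat (length vs) (length vs)"
    by (simp add: A adjacency_matrix_def)
  then have Lc: "L \<in> carrier_mat (length vs) (length vs)"
    by (simp add: L A laplacian_matrix_SR_3[OF vs])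
  have LA: "eigenvalue_mset L = image_mset (\<lambda>k. 2 * of_nat n - k) (eigenvalue_mset A)"
    using eigenvalue_mset_affine[OF Ac, of "2 * of_nat n" "-1"]
    by (simp add: L A laplacian_matrix_SR_3[OF vs])
  have LA_int: "eigenvalue_mset L = image_mset of_int U'"
    if "eigenvalue_mset A = image_mset of_int U" "image_mset (\<lambda>k. 2 * int n - k) U = U'" for U U'
    unfolding LA that(1) that(2)[symmetric] by (simp add: image_mset.compositionality o_def)
  note A_mset = eigenvalue_mset_SR_3[OF n vs, folded A]
  \<comment> \<open>\<open>refl\<close> instantiates \<open>U\<close> with the explicit multiset, so
    that these facts resolve directly against the goals.\<close>
  note odd = SR_3_multiplicities_odd[OF _ refl]
  note even = SR_3_multiplicities_even[OF _ n refl]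
  \<comment> \<open>Integrality only requires that, in either parity, the spectrum comes from some
    multiset of integers.\<close>
  have "\<exists>U. eigenvalue_mset A = image_mset of_int U"
    using A_mset[OF odd(1)] A_mset[OF even(1)] oddE evenE by metis
  then obtain U where U: "eigenvalue_mset A = image_mset of_int U" ..
  have "integral_graph (SR_adj 3) vs"
    using U unfolding integral_graph_def A[symmetric] in_eigenvalue_mset_iff[OF Ac, symmetric] by auto
  moreover have "laplacian_integral_graph (SR_adj 3) vs"
    using LA_int[OF U refl]
    unfolding laplacian_integral_graph_def L[symmetric] in_eigenvalue_mset_iff[OF Lc, symmetric] by auto
  ultimately show ?thesis
    using LA
    by (intro conjI allI impI)
      (assumption | rule A_mset[OF odd(1)] A_mset[OF even(1)]
        LA_int[OF A_mset[OF odd(1)] odd(2)] LA_int[OF A_mset[OF even(1)] even(2)])+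
qed

end
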